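(* Let $d\in\mathbb{N}$, $d>0$, $M=[0,1]^d$, and let $X_1,\dots,X_n$ be i.i.d. data drawn from a density $f$ with respect to $d$-dimensional Lebesgue measure, with support $M$, where $f$ is zero on $\mathbb{R}^d\setminus M$ and continuous on $M$. Let $S_0=\{\boldsymbol{x}\in M:f(\boldsymbol{x})=0\}$ be its zero-density region, of Minkowski dimension $d_0<d$, and suppose $S_0$ is contained in the interior of $M$ and has one connected component. Assume: (i) there exists $\epsilon_0>0$ such that $\overline{K_f}(\epsilon_0)>0$ and $\underline{K_f}(\epsilon_0)>0$ exist (so that the limits $\overline{K_f}>0$ and $\underline{K_f}>0$ also exist); (ii) there exist positive constants $L_f,U_f$ such that for all $\epsilon$ with $0<\epsilon<\min(1,\epsilon_0)$ and all $\boldsymbol{x}\in B_\epsilon(S_0)\cap M$, $$L_f\, d(\boldsymbol{x},S_0)^{\overline{K_f}(\epsilon)}\le f(\boldsymbol{x})\le U_f\, d(\boldsymbol{x},S_0)^{\underline{K_f}(\epsilon)};$$ (iii) $\mathcal{B}^d_{r(n)}(M)$ is a sequence of coverings of $M$ by balls of radius $r(n)$ with centers in $M$, where $r(n)\sim O(n^{-\eta})$, $0<\eta<\frac1d$, and $|\mathcal{B}^d_{r(n)}(M)|\sim O(n^{d\eta})$; (iv) for each $\tau>0$, the number of balls in $\mathcal{B}^d_{r(n)}(M)$ intersecting $S_0$ is bounded from above by some $H_\tau(n)\sim O(n^{d_0\eta(1+\tau)})$; (v) $\epsilon(n)\sim O(n^{-\psi})$ with $0<\psi\le\eta$, and $2r(n)\le\epsilon(n)<1$;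 (vi) $m(f,n):=\min_{\boldsymbol{w}\in M\setminus B_{\epsilon(n)}(S_0)}f(\boldsymbol{w})\in(0,\infty)$ and $m(f,n)\sim O(n^{-\xi})$ for some $0<\xi<\frac{1-2\eta d}{2}$. Then: (A) If $1-2\eta d-2\overline{K_f}\,\psi>0$, then $\lim_{n\to\infty}P(\text{there are no empty }\epsilon(n)\text{-outside balls})=1$. (B) If $1+d_0\eta-\underline{K_f}\,\eta-d\eta<0$, then $\lim_{n\to\infty}P(\text{all }\epsilon(n)\text{-inside balls are empty})=1$.
   Context: Balls are open Euclidean balls $B_r(\boldsymbol{x})=\{\boldsymbol{y}\in\mathbb{R}^d:\|\boldsymbol{x}-\boldsymbol{y}\|<r\}$; $d(\boldsymbol{x},S_0)=\inf_{\boldsymbol{y}\in S_0}\|\boldsymbol{x}-\boldsymbol{y}\|$; $B_\epsilon(S_0)=\{\boldsymbol{x}\in\mathbb{R}^d: d(\boldsymbol{x},S_0)<\epsilon\}$. A covering of a set is a collection of balls whose union contains the set; $|\cdot|$ denotes its cardinality. Support: the support of a random vector $X$ with density $f$ is the intersection of all closed sets $R\subset\mathbb{R}^d$ with $P(X\in R)=1$. Upper and lower $\epsilon$-order of smoothness: $$\overline{K_f}(\epsilon)=\inf\Big\{\alpha>0: 0<\inf_{\boldsymbol{x}\in B_\epsilon(S_0)\setminus S_0}\frac{f(\boldsymbol{x})}{d(\boldsymbol{x},S_0)^\alpha}\Big\},\qquad \underline{K_f}(\epsilon)=\sup\Big\{\alpha>0: \infty>\sup_{\boldsymbol{x}\in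 B_\epsilon(S_0)\setminus S_0}\frac{f(\boldsymbol{x})}{d(\boldsymbol{x},S_0)^\alpha}\Big\},$$ and $\overline{K_f}=\lim_{\epsilon\to0^+}\overline{K_f}(\epsilon)$, $\underline{K_f}=\lim_{\epsilon\to0^+}\underline{K_f}(\epsilon)$ (upper and lower order of smoothness). Types of balls of the covering: $B_{r}(\boldsymbol{x})$ is an $\epsilon$-outside ball if $\boldsymbol{x}\notin B_\epsilon(S_0)$; an $\epsilon$-inside ball if $\boldsymbol{x}\in B_\epsilon(S_0)$ and $B_r(\boldsymbol{x})\cap S_0\neq\emptyset$. In the conclusions these refer to balls in the covering $\mathcal{B}^d_{r(n)}(M)$ with $r=r(n)$, $\epsilon=\epsilon(n)$. A ball is empty if it contains none of $X_1,\dots,X_n$. Big O convention (two-sided): for positive real sequences $a(n),b(n)$, $a\sim O(b)$ means there are constants $L_1,L_2\in(0,\infty)$ and $n_0\in\mathbb{N}$ with $L_1 b(n)\le a(n)\le L_2 b(n)$ for all $n>n_0$. Minkowski (box-counting) dimension: for bounded $E\subset\mathbb{R}^d$ let $\mathcal{N}_\Delta(E)$ be the smallest number of balls of radius $\Delta>0$ needed to cover $E$; the Minkowski dimension of $E$ is $\lim_{\Delta\to0}\log\mathcal{N}_\Delta(E)/(-\log\Delta)$ when this limit exists. *)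

theory Defs
  imports "HOL-Probability.Probability"
begin

definition unit_cube :: "(real ^ 'n) set" where
  "unit_cube = cbox 0 1"

definition zero_density_region :: "(real ^ 'n) set \<Rightarrow> (real ^ 'n \<Rightarrow> real) \<Rightarrow> (real ^ 'n) set" where
  "zero_density_region M f = {x \<in> M. f x = 0}"

text \<open>Note that \<^const>\<open>infdist\<close> is 0 by convention for an empty set; the sets S used as
  arguments below are nonempty.\<close>
definition eps_nbhd :: "real \<Rightarrow> 'a::metric_space set \<Rightarrow> 'a set" where
  "eps_nbhd \<epsilon> S = {x. infdist x S < \<epsilon>}"

definition rv_support :: "'w measure \<Rightarrow> ('w \<Rightarrow> 'a::topological_space) \<Rightarrow> 'a set" where
  "rv_support P X = \<Inter>{R. closed R \<and> measure P {\<omega> \<in> space P. X \<omega> \<in> R} = 1}"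

text \<open>The orders of smoothness are extended reals, so that the infimum of the empty set is
  \<open>\<infinity>\<close>, the supremum of the empty set is \<open>-\<infinity>\<close>, and "the order exists and is positive"
  means that it lies strictly between 0 and \<open>\<infinity>\<close>.\<close>

definition upper_eps_order :: "('a::metric_space \<Rightarrow> real) \<Rightarrow> 'a set \<Rightarrow> real \<Rightarrow> ereal" where
  "upper_eps_order f S \<epsilon> = Inf (ereal ` {\<alpha>. 0 < \<alpha> \<and>
     0 < (INF x \<in> eps_nbhd \<epsilon> S - S. ereal (f x / infdist x S powr \<alpha>))})"

definition lower_eps_order :: "('a::metric_space \<Rightarrow> real) \<Rightarrow> 'a set \<Rightarrow> real \<Rightarrow> ereal" where
  "lower_eps_order f S \<epsilon> = Sup (ereal ` {\<alpha>. 0 < \<alpha> \<and>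
     (SUP x \<in> eps_nbhd \<epsilon> S - S. ereal (f x / infdist x S powr \<alpha>)) < \<infinity>})"

definition upper_order :: "('a::metric_space \<Rightarrow> real) \<Rightarrow> 'a set \<Rightarrow> ereal" where
  "upper_order f S = Lim (at_right 0) (upper_eps_order f S)"

definition lower_order :: "('a::metric_space \<Rightarrow> real) \<Rightarrow> 'a set \<Rightarrow> ereal" where
  "lower_order f S = Lim (at_right 0) (lower_eps_order f S)"

text \<open>A collection of balls of a common radius r > 0 in Euclidean space is represented by the set
  C of its centers. Different centers give different balls, so the collection has card C
  elements.\<close>

definition ball_covering :: "'a::metric_space set \<Rightarrow> real \<Rightarrow> 'a set \<Rightarrow> bool" where
  "ball_covering C r A \<longleftrightarrow> finite C \<and> A \<subseteq> (\<Union>x\<in>C. ball x r)"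

definition covering_number :: "real \<Rightarrow> 'a::metric_space set \<Rightarrow> nat" where
  "covering_number \<Delta> E = (LEAST k. \<exists>C. ball_covering C \<Delta> E \<and> card C = k)"

definition has_minkowski_dimension :: "'a::metric_space set \<Rightarrow> real \<Rightarrow> bool" where
  "has_minkowski_dimension E s \<longleftrightarrow>
     ((\<lambda>\<Delta>. ln (real (covering_number \<Delta> E)) / (- ln \<Delta>)) \<longlongrightarrow> s) (at_right 0)"

text \<open>Sequences are indexed by n \<open>\<ge>\<close> 1; their value at index 0 is irrelevant. The positivity
  of the two sequences is part of the convention.\<close>
definition two_sided_O :: "(nat \<Rightarrow> real) \<Rightarrow> (nat \<Rightarrow> real) \<Rightarrow> bool" where
  "two_sided_O a b \<longleftrightarrow> (\<forall>n\<ge>1. 0 < a n \<and> 0 < b n) \<and>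
     (\<exists>L1>0. \<exists>L2>0. \<exists>n0. \<forall>n>n0. L1 * b n \<le> a n \<and> a n \<le> L2 * b n)"

definition is_minimum_on :: "('a \<Rightarrow> real) \<Rightarrow> 'a set \<Rightarrow> real \<Rightarrow> bool" where
  "is_minimum_on f A m \<longleftrightarrow> (\<exists>w\<in>A. f w = m) \<and> (\<forall>w\<in>A. m \<le> f w)"

definition outside_ball :: "real \<Rightarrow> 'a::metric_space set \<Rightarrow> 'a \<Rightarrow> bool" where
  "outside_ball \<epsilon> S x \<longleftrightarrow> x \<notin> eps_nbhd \<epsilon> S"

definition inside_ball :: "real \<Rightarrow> 'a::metric_space set \<Rightarrow> real \<Rightarrow> 'a \<Rightarrow> bool" where
  "inside_ball \<epsilon> S r x \<longleftrightarrow> x \<in> eps_nbhd \<epsilon> S \<and> ball x r \<inter> S \<noteq> {}"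

definition empty_ball ::
    "(nat \<Rightarrow> 'w \<Rightarrow> 'a::metric_space) \<Rightarrow> nat \<Rightarrow> 'w \<Rightarrow> real \<Rightarrow> 'a \<Rightarrow> bool" where
  "empty_ball X n \<omega> r x \<longleftrightarrow> (\<forall>i\<in>{1..n}. X i \<omega> \<notin> ball x r)"

end

theory Submission
  imports Defs "HOL-Real_Asymp.Real_Asymp"
begin

text \<open>
  Both limits come from a union bound over the balls, in which the density enters only through its
  bounds on a single ball. Let \<open>d\<close> be the dimension and \<open>K\<close> the order of smoothness of the density
  at its zero set \<open>S\<close>, upper for the first claim and lower for the second.

  \<^emph>\<open>Outside balls are hit.\<close> An outside ball has its center at distance at least \<open>\<epsilon>(n) \<ge> 2 r(n)\<close> from
  \<open>S\<close>, so all its points keep distance at least \<open>\<epsilon>(n) / 2\<close>. There the density is at least a constant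
  times \<open>n powr (- \<beta>)\<close>, where \<open>\<beta> = max \<xi> (\<psi> * k)\<close>: points at distance at least \<open>\<epsilon>(n)\<close> are governed by
  the minimum of order \<open>n powr (- \<xi>)\<close>, the others by the lower density bound whose exponent \<open>k\<close>
  is the upper order at a small fixed scale. As the cube contains a fixed proportion of each ball
  centered in it, a sample point hits the ball with probability at least a constant times
  \<open>n powr (- \<eta> * d - \<beta>)\<close>. By independence (\<open>prob_sample_avoids_le\<close>), all \<open>n\<close> points miss it with
  probability at most \<open>exp (- c * n powr (1 - \<eta> * d - \<beta>))\<close>. The hypotheses on \<open>\<xi>\<close> and on \<open>K\<close> make
  this last exponent positive, and the decay beats the polynomial number of balls.

  \<^emph>\<open>Inside balls are missed.\<close> An inside ball meets \<open>S\<close>, so all its points are within \<open>2 r(n)\<close> of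
  \<open>S\<close>, and a sample point hits it with probability at most a constant times
  \<open>n powr (- \<eta> * (d + k))\<close>, with \<open>k\<close> the lower order at a small fixed scale. There are \<open>n\<close> sample
  points and at most a constant times \<open>n powr (d0 * \<eta> * (1 + \<tau>))\<close> such balls. The expected number
  of hits is thus of order \<open>n powr s\<close>, where \<open>s\<close> exceeds \<open>1 + d0 * \<eta> - K * \<eta> - d * \<eta> < 0\<close> by as little
  as desired once \<open>\<tau>\<close> and the scale are small.

  What allows a scale to be fixed is that the orders at scale \<open>\<epsilon>\<close> are monotone in \<open>\<epsilon>\<close>, hence converge
  to their infimum and supremum, and that both limits are finite. For the lower order finiteness
  is not evident from its value at one scale, as it may grow when the scale shrinks; it follows
  because the lower order never exceeds the upper one (\<open>lower_eps_order_le_upper_eps_order\<close>).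
\<close>

section \<open>Orders of smoothness\<close>

lemma eps_nbhd_mono: "a \<le> b \<Longrightarrow> eps_nbhd a S \<subseteq> eps_nbhd b S"
  by (auto simp: eps_nbhd_def)

lemma upper_eps_order_mono:
  assumes "a \<le> b"
  shows "upper_eps_order f S a \<le> upper_eps_order f S b"
proof -
  have "(INF x \<in> eps_nbhd b S - S. ereal (f x / infdist x S powr \<alpha>))
      \<le> (INF x \<in> eps_nbhd a S - S. ereal (f x / infdist x S powr \<alpha>))" for \<alpha>
    using eps_nbhd_mono[OF assms, of S] by (intro INF_superset_mono) auto
  then show ?thesis
    unfolding upper_eps_order_def
    by (intro Inf_superset_mono image_mono Collect_mono) (meson less_le_trans)
qed

lemma lower_eps_order_antimono:
  assumes "a \<le> b"
  shows "lower_eps_order f S b \<le> lower_eps_order f S a"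
proof -
  have "(SUP x \<in> eps_nbhd a S - S. ereal (f x / infdist x S powr \<alpha>))
      \<le> (SUP x \<in> eps_nbhd b S - S. ereal (f x / infdist x S powr \<alpha>))" for \<alpha>
    using eps_nbhd_mono[OF assms, of S] by (intro SUP_subset_mono) auto
  then show ?thesis
    unfolding lower_eps_order_def
    by (intro Sup_subset_mono image_mono Collect_mono) (meson le_less_trans)
qed

lemma tendsto_at_right_INF_mono:
  fixes F :: "real \<Rightarrow> 'a::{complete_linorder, linorder_topology}"
  assumes "\<And>a b. a \<le> b \<Longrightarrow> F a \<le> F b"
  shows "(F \<longlongrightarrow> (INF e\<in>{0<..}. F e)) (at_right 0)"
proof (rule order_tendstoI)
  fix a assume "a < (INF e\<in>{0<..}. F e)"
  then have "a < F x" if "x > 0" for x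
    using less_INF_D that by fastforce
  then show "\<forall>\<^sub>F x in at_right 0. a < F x"
    by (auto simp: eventually_at_filter)
next
  fix a assume "(INF e\<in>{0<..}. F e) < a"
  then obtain e where "e > 0" "F e < a"
    by (auto simp: INF_less_iff)
  then have "\<And>x. x < e \<Longrightarrow> F x < a"
    using assms by (meson le_less_trans less_imp_le)
  then show "\<forall>\<^sub>F x in at_right 0. F x < a"
    using \<open>e > 0\<close> by (auto simp: eventually_at_right_field)
qed

lemma tendsto_at_right_SUP_antimono:
  fixes F :: "real \<Rightarrow> 'a::{complete_linorder, linorder_topology}"
  assumes "\<And>a b. a \<le> b \<Longrightarrow> F b \<le> F a"
  shows "(F \<longlongrightarrow> (SUP e\<in>{0<..}. F e)) (at_right 0)"
proof (rule order_tendstoI)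
  fix a assume "a < (SUP e\<in>{0<..}. F e)"
  then obtain e where "e > 0" "a < F e"
    by (auto simp: less_SUP_iff)
  then have "\<And>x. x < e \<Longrightarrow> a < F x"
    using assms by (meson less_le_trans less_imp_le)
  then show "\<forall>\<^sub>F x in at_right 0. a < F x"
    using \<open>e > 0\<close> by (auto simp: eventually_at_right_field)
next
  fix a assume "(SUP e\<in>{0<..}. F e) < a"
  then have "F x < a" if "x > 0" for x
    using SUP_lessD that by fastforce
  then show "\<forall>\<^sub>F x in at_right 0. F x < a"
    by (auto simp: eventually_at_filter)
qed

lemma upper_order_eq_INF: "upper_order f S = (INF e\<in>{0<..}. upper_eps_order f S e)"
  unfolding upper_order_def
  by (intro tendsto_Lim tendsto_at_right_INF_mono upper_eps_order_mono) auto

lemma lower_order_eq_SUP: "lower_order f S = (SUP e\<in>{0<..}. lower_eps_order f S e)"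
  unfolding lower_order_def
  by (intro tendsto_Lim tendsto_at_right_SUP_antimono lower_eps_order_antimono) auto

text \<open>By connectedness: otherwise \<open>S\<close> would coincide with an open neighbourhood of itself and be
  both open and closed.\<close>

lemma infdist_arbitrarily_small:
  fixes S :: "'a::euclidean_space set"
  assumes "closed S" "S \<noteq> {}" "S \<noteq> UNIV" "\<delta> > 0"
  obtains x where "0 < infdist x S" "infdist x S < \<delta>" "x \<notin> S"
proof -
  have "\<not> open S"
    using clopen[of S] assms by auto
  moreover have "open {x. infdist x S < \<delta>}"
    by (intro open_Collect_less continuous_intros)
  ultimately obtain x where "x \<notin> S" "infdist x S < \<delta>"
    using assms(4) by (metis (mono_tags, lifting) in_closed_iff_infdist_zero[OF assms(1,2)]
        mem_Collect_eq subsetI subset_antisym)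
  then show thesis
    using that infdist_pos_not_in_closed[OF assms(1,2)] by blast
qed

text \<open>If \<open>f\<close> is bounded below by a multiple of \<open>infdist x S powr \<alpha>\<close> and above by a multiple of
  \<open>infdist x S powr \<beta>\<close>, then letting \<open>x\<close> approach \<open>S\<close> from outside forces \<open>\<beta> \<le> \<alpha>\<close>. Such
  points exist because \<open>S\<close> is closed, nonempty and not the whole space.\<close>

lemma lower_eps_order_le_upper_eps_order:
  fixes S :: "'a::euclidean_space set"
  assumes S: "closed S" "S \<noteq> {}" "S \<noteq> UNIV" and "e > 0"
  shows "lower_eps_order f S e \<le> upper_eps_order f S e"
proof -
  have "\<beta> \<le> \<alpha>"
    if \<alpha>: "0 < (INF x \<in> eps_nbhd e S - S. ereal (f x / infdist x S powr \<alpha>))"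
      and \<beta>: "(SUP x \<in> eps_nbhd e S - S. ereal (f x / infdist x S powr \<beta>)) < \<infinity>" for \<alpha> \<beta>
  proof (rule ccontr)
    assume "\<not> \<beta> \<le> \<alpha>"
    obtain c where c: "0 < c" "\<And>x. x \<in> eps_nbhd e S - S \<Longrightarrow> c \<le> f x / infdist x S powr \<alpha>"
    proof -
      obtain c where "0 < ereal c" "ereal c < (INF x \<in> eps_nbhd e S - S. ereal (f x / infdist x S powr \<alpha>))"
        using ereal_dense2[OF \<alpha>] by auto
      then show thesis
        using that[of c] by (force dest: less_INF_D)
    qed
    obtain D where D: "0 < D" "\<And>x. x \<in> eps_nbhd e S - S \<Longrightarrow> f x / infdist x S powr \<beta> \<le> D"
    proof -
      obtain D where "(SUP x \<in> eps_nbhd e S - S. ereal (f x / infdist x S powr \<beta>)) < ereal D"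
        using ereal_dense2[OF \<beta>] by auto
      then have "f x / infdist x S powr \<beta> \<le> max D 1" if "x \<in> eps_nbhd e S - S" for x
        using that by (force dest: SUP_lessD)
      then show thesis
        using that[of "max D 1"] by auto
    qed
    \<comment> \<open>below this distance the power with exponent \<open>\<beta> - \<alpha>\<close> is smaller than \<open>c / D\<close>\<close>
    define \<delta> where "\<delta> = min e ((c / D) powr (1 / (\<beta> - \<alpha>)))"
    have "\<delta> > 0"
      using c(1) D(1) \<open>e > 0\<close> by (simp add: \<delta>_def)
    then obtain x where x: "0 < infdist x S" "infdist x S < \<delta>" "x \<notin> S"
      using infdist_arbitrarily_small[OF S] by blast
    let ?t = "infdist x S"
    have mem: "x \<in> eps_nbhd e S - S"
      using x by (auto simp: eps_nbhd_def \<delta>_def)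
    have "c * ?t powr \<alpha> \<le> f x" "f x \<le> D * ?t powr \<beta>"
      using c(2)[OF mem] D(2)[OF mem] x(1) by (simp_all add: field_simps)
    then have "c * ?t powr \<alpha> \<le> D * (?t powr (\<beta> - \<alpha>) * ?t powr \<alpha>)"
      by (simp flip: powr_add)
    then have "c / D \<le> ?t powr (\<beta> - \<alpha>)"
      using x(1) D(1) by (simp add: field_simps)
    also have "\<dots> < ((c / D) powr (1 / (\<beta> - \<alpha>))) powr (\<beta> - \<alpha>)"
      using x \<open>\<not> \<beta> \<le> \<alpha>\<close> by (intro powr_less_mono2) (auto simp: \<delta>_def)
    also have "\<dots> = c / D"
      using c(1) D(1) \<open>\<not> \<beta> \<le> \<alpha>\<close> by (simp add: powr_powr)
    finally show False by simp
  qed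
  then show ?thesis
    unfolding lower_eps_order_def upper_eps_order_def
    by (intro Sup_least Inf_greatest) auto
qed

text \<open>Since \<open>real_of_ereal\<close> sends infinite values to 0, this and the next lemma carry the finiteness of
  the orders as well as the approximation of the limit order by the order at a single scale.\<close>

lemma upper_order_approx:
  assumes fin: "upper_eps_order f S e0 < \<infinity>" and "0 < e0" "0 < \<delta>"
  obtains e where "0 < e" "e < e0"
    "0 \<le> real_of_ereal (upper_eps_order f S e)"
    "real_of_ereal (upper_eps_order f S e) < real_of_ereal (upper_order f S) + \<delta>"
proof -
  let ?U = "upper_eps_order f S"
  have nonneg: "0 \<le> ?U e" for e
    unfolding upper_eps_order_def by (intro Inf_greatest) auto
  have fin': "\<bar>?U e\<bar> \<noteq> \<infinity>" if "e \<le> e0" for e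
    using nonneg[of e] fin upper_eps_order_mono[OF that, of f S] by auto
  have "0 \<le> upper_order f S" "upper_order f S \<le> ?U e0"
    unfolding upper_order_eq_INF using nonneg \<open>0 < e0\<close>
    by (auto intro: INF_greatest INF_lower)
  then have "\<bar>upper_order f S\<bar> \<noteq> \<infinity>"
    using fin by auto
  then obtain u where u: "upper_order f S = ereal u"
    by auto
  have "(INF e\<in>{0<..}. ?U e) < ereal (u + \<delta>)"
    using u \<open>0 < \<delta>\<close> by (simp flip: upper_order_eq_INF)
  then obtain e1 where e1: "e1 > 0" "?U e1 < ereal (u + \<delta>)"
    by (auto simp: INF_less_iff)
  define e where "e = min e1 (e0 / 2)"
  have "?U e < ereal (u + \<delta>)"
    using e1 upper_eps_order_mono[of e e1 f S] by (auto simp: e_def)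
  moreover have "0 < e" "e < e0"
    using e1 \<open>0 < e0\<close> by (auto simp: e_def)
  moreover obtain v where "?U e = ereal v"
    using fin'[of e] \<open>e < e0\<close> by auto
  ultimately show thesis
    using that[of e] u nonneg[of e] by auto
qed

lemma lower_order_approx:
  fixes S :: "'a::euclidean_space set"
  assumes S: "closed S" "S \<noteq> {}" "S \<noteq> UNIV"
    and pos: "0 < lower_eps_order f S e0" and fin: "upper_eps_order f S e0 < \<infinity>"
    and "0 < e0" "0 < \<delta>"
  obtains e where "0 < e" "e < e0"
    "0 \<le> real_of_ereal (lower_eps_order f S e)"
    "real_of_ereal (lower_order f S) - \<delta> < real_of_ereal (lower_eps_order f S e)"
proof -
  let ?L = "lower_eps_order f S"
  \<comment> \<open>the bound is uniform in \<open>e\<close>, so that it passes to the supremum\<close>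
  have bd: "?L e \<le> upper_eps_order f S e0" if "e > 0" for e
  proof -
    have "?L e \<le> ?L (min e e0)"
      by (intro lower_eps_order_antimono) auto
    also have "\<dots> \<le> upper_eps_order f S (min e e0)"
      using that \<open>0 < e0\<close> by (intro lower_eps_order_le_upper_eps_order S) auto
    also have "\<dots> \<le> upper_eps_order f S e0"
      by (intro upper_eps_order_mono) auto
    finally show ?thesis .
  qed
  have pos': "0 < ?L e" if "e \<le> e0" for e
    using pos lower_eps_order_antimono[OF that, of f S] by auto
  have fin': "\<bar>?L e\<bar> \<noteq> \<infinity>" if "0 < e" "e \<le> e0" for e
    using bd[OF that(1)] pos'[OF that(2)] fin by auto
  have "?L e0 \<le> lower_order f S" "lower_order f S \<le> upper_eps_order f S e0"
    unfolding lower_order_eq_SUP using bd \<open>0 < e0\<close>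
    by (auto intro: SUP_least SUP_upper)
  then have "\<bar>lower_order f S\<bar> \<noteq> \<infinity>"
    using fin pos by auto
  then obtain u where u: "lower_order f S = ereal u"
    by auto
  have "ereal (u - \<delta>) < (SUP e\<in>{0<..}. ?L e)"
    using u \<open>0 < \<delta>\<close> by (simp flip: lower_order_eq_SUP)
  then obtain e1 where e1: "e1 > 0" "ereal (u - \<delta>) < ?L e1"
    by (auto simp: less_SUP_iff)
  define e where "e = min e1 (e0 / 2)"
  have "ereal (u - \<delta>) < ?L e"
    using e1 lower_eps_order_antimono[of e e1 f S] by (auto simp: e_def)
  moreover have "0 < e" "e < e0"
    using e1 \<open>0 < e0\<close> by (auto simp: e_def)
  moreover obtain v where "?L e = ereal v"
    using fin'[of e] \<open>0 < e\<close> \<open>e < e0\<close> by auto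
  ultimately show thesis
    using that[of e] u pos'[of e] by auto
qed

section \<open>Volume and probability of balls\<close>

text \<open>The contraction of the unit cube towards \<open>x\<close> with factor \<open>s\<close> stays in the cube by convexity,
  has volume \<open>s\<close> to the power of the dimension, and lies near \<open>x\<close> because two points of the cube
  have distance at most the dimension. Thus a ball centered in the cube cannot lose
  more than a fixed proportion of its volume to the complement, even at a corner.\<close>

lemma unit_cube_contains_small_cube:
  fixes x :: "real ^ 'n"
  assumes x: "x \<in> unit_cube" and s: "0 < s" "s \<le> 1"
  obtains D where "D \<in> sets borel" "emeasure lborel D = ennreal (s ^ CARD('n))"
    "D \<subseteq> unit_cube" "D \<subseteq> cball x (s * real CARD('n))"
proof
  let ?D = "(\<lambda>y. s *\<^sub>R y + (1 - s) *\<^sub>R x) ` unit_cube"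
  have content_cube: "measure lborel (cbox 0 (1 :: real ^ 'n)) = 1"
    by (subst content_cbox_cart) (auto simp: interval_ne_empty_cart)
  have compact: "compact ?D"
    unfolding unit_cube_def by (intro compact_continuous_image continuous_intros compact_cbox)
  then show "?D \<in> sets borel"
    by (intro borel_closed compact_imp_closed)
  have "measure lborel ?D = s ^ CARD('n)"
    unfolding unit_cube_def content_image_affinity_cbox using s by (simp add: content_cube)
  then show "emeasure lborel ?D = ennreal (s ^ CARD('n))"
    using emeasure_eq_ennreal_measure[of lborel ?D] emeasure_compact_finite[OF compact]
    by (auto simp: top.not_eq_extremum)
  show "?D \<subseteq> unit_cube"
    using convexD[OF convex_box(1)[of 0 1], of _ x s "1 - s"] x s by (auto simp: unit_cube_def)
  show "?D \<subseteq> cball x (s * real CARD('n))"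
  proof clarify
    fix y :: "real ^ 'n" assume y: "y \<in> unit_cube"
    have "norm (x - y) \<le> (\<Sum>i\<in>UNIV. \<bar>(x - y) $ i\<bar>)"
      by (rule norm_le_l1_cart)
    also have "\<dots> \<le> (\<Sum>i\<in>(UNIV :: 'n set). 1)"
      using x y by (intro sum_mono) (auto simp: unit_cube_def mem_box_cart abs_le_iff,
        (smt (verit))+)
    finally have "s * norm (x - y) \<le> s * real CARD('n)"
      using s by simp
    moreover have "x - (s *\<^sub>R y + (1 - s) *\<^sub>R x) = s *\<^sub>R (x - y)"
      by (simp add: algebra_simps)
    ultimately show "s *\<^sub>R y + (1 - s) *\<^sub>R x \<in> cball x (s * real CARD('n))"
      using s by (simp add: dist_norm)
  qed
qed

lemma (in prob_space) prob_ge_density_lower_bound: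
  assumes dist: "distributed M lborel X (\<lambda>x. ennreal (f x))"
    and D: "D \<in> sets borel" "D \<subseteq> A" "emeasure lborel D = ennreal v" and A: "A \<in> sets borel"
    and c: "0 \<le> c" "0 \<le> v" "\<And>y. y \<in> D \<Longrightarrow> c \<le> f y"
  shows "c * v \<le> prob {\<omega> \<in> space M. X \<omega> \<in> A}"
proof -
  have "ennreal (c * v) = (\<integral>\<^sup>+ y. ennreal c * indicator D y \<partial>lborel)"
    using c D by (simp add: nn_integral_cmult_indicator ennreal_mult)
  also have "\<dots> \<le> (\<integral>\<^sup>+ y. ennreal (f y) * indicator A y \<partial>lborel)"
    using D(2) c(3) by (intro nn_integral_mono) (auto simp: indicator_def ennreal_leI)
  also have "\<dots> = emeasure M (X -` A \<inter> space M)"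
    using distributed_emeasure[OF dist] A by simp
  also have "X -` A \<inter> space M = {\<omega> \<in> space M. X \<omega> \<in> A}"
    by auto
  finally show ?thesis
    by (simp add: emeasure_eq_measure)
qed

lemma (in prob_space) prob_le_density_upper_bound:
  assumes dist: "distributed M lborel X (\<lambda>x. ennreal (f x))"
    and A: "A \<in> sets borel" "emeasure lborel A = ennreal v"
    and c: "0 \<le> c" "0 \<le> v" "\<And>y. y \<in> A \<Longrightarrow> f y \<le> c"
  shows "prob {\<omega> \<in> space M. X \<omega> \<in> A} \<le> c * v"
proof -
  have "emeasure M {\<omega> \<in> space M. X \<omega> \<in> A} = emeasure M (X -` A \<inter> space M)"
    by (intro arg_cong[where f = "emeasure M"]) auto
  also have "\<dots> = (\<integral>\<^sup>+ y. ennreal (f y) * indicator A y \<partial>lborel)"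
    using distributed_emeasure[OF dist] A by simp
  also have "\<dots> \<le> (\<integral>\<^sup>+ y. ennreal c * indicator A y \<partial>lborel)"
    using c(3) by (intro nn_integral_mono) (auto simp: indicator_def ennreal_leI)
  also have "\<dots> = ennreal (c * v)"
    using c A by (simp add: nn_integral_cmult_indicator ennreal_mult)
  finally show ?thesis
    using c by (simp add: emeasure_eq_measure)
qed

lemma (in prob_space) prob_ball_centered_in_cube_ge:
  fixes X :: "'a \<Rightarrow> real ^ 'n"
  assumes dist: "distributed M lborel X (\<lambda>x. ennreal (f x))"
    and x: "x \<in> unit_cube" and \<rho>: "0 < \<rho>" "\<rho> \<le> 1"
    and c: "0 \<le> c" "\<And>y. y \<in> unit_cube \<Longrightarrow> y \<in> ball x \<rho> \<Longrightarrow> c \<le> f y"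
  shows "c * (\<rho> / (2 * real CARD('n))) ^ CARD('n) \<le> prob {\<omega> \<in> space M. X \<omega> \<in> ball x \<rho>}"
proof -
  let ?s = "\<rho> / (2 * real CARD('n))"
  have s: "0 < ?s" "?s \<le> 1"
  proof -
    show "0 < ?s"
      using \<rho> by simp
    have "1 \<le> real CARD('n)"
      by (simp add: Suc_leI)
    then have "\<rho> \<le> 2 * real CARD('n)"
      using \<rho> by linarith
    then show "?s \<le> 1"
      by simp
  qed
  obtain D where D: "D \<in> sets borel" "emeasure lborel D = ennreal (?s ^ CARD('n))"
      "D \<subseteq> unit_cube" "D \<subseteq> cball x (?s * real CARD('n))"
    using unit_cube_contains_small_cube[OF x s] by blast
  have D_ball: "D \<subseteq> ball x \<rho>"
    using \<rho> by (intro order_trans[OF D(4)]) auto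
  show ?thesis
    using D(3) D_ball c s
    by (intro prob_ge_density_lower_bound[OF dist D(1) D_ball D(2)]) (auto simp: subset_iff)
qed

lemma (in prob_space) prob_ball_le:
  fixes X :: "'a \<Rightarrow> 'b::euclidean_space"
  assumes dist: "distributed M lborel X (\<lambda>x. ennreal (f x))"
    and "0 \<le> \<rho>" "0 \<le> c" "\<And>y. y \<in> ball x \<rho> \<Longrightarrow> f y \<le> c"
  shows "prob {\<omega> \<in> space M. X \<omega> \<in> ball x \<rho>} \<le> c * (unit_ball_vol (real DIM('b)) * \<rho> ^ DIM('b))"
  using assms by (intro prob_le_density_upper_bound[OF dist]) (auto simp: emeasure_ball)

section \<open>Union bounds for samples and finite families of balls\<close>

text \<open>Independence gives the product of the single probabilities, and \<open>1 - p \<le> exp (- p)\<close>.\<close>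

lemma (in prob_space) prob_sample_avoids_le:
  assumes indep: "indep_vars (\<lambda>_. N) X {1..}" and A: "A \<in> sets N"
    and p: "\<And>i. i \<ge> 1 \<Longrightarrow> p \<le> prob {\<omega> \<in> space M. X i \<omega> \<in> A}"
  shows "prob {\<omega> \<in> space M. \<forall>i\<in>{1..n}. X i \<omega> \<notin> A} \<le> exp (- (real n * p))"
proof (cases "n = 0")
  case False
  have meas: "X i \<in> measurable M N" if "i \<ge> 1" for i
    using indep that unfolding indep_vars_def by auto
  have single: "prob (X i -` (space N - A) \<inter> space M) \<le> exp (- p)" if i: "i \<ge> 1" for i
  proof -
    have "X i -` (space N - A) \<inter> space M = space M - {\<omega> \<in> space M. X i \<omega> \<in> A}"
      using measurable_space[OF meas[OF i]] by auto
    then have "prob (X i -` (space N - A) \<inter> space M) = 1 - prob {\<omega> \<in> space M. X i \<omega> \<in> A}"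
      using prob_compl measurable_sets_Collect[OF meas[OF i], of "\<lambda>y. y \<in> A"] A
        sets.sets_into_space[OF A] by (simp add: Int_absorb1 Collect_conj_eq)
    also have "\<dots> \<le> exp (- p)"
      using p[OF i] exp_ge_add_one_self[of "- p"] by simp
    finally show ?thesis .
  qed
  have "{\<omega> \<in> space M. \<forall>i\<in>{1..n}. X i \<omega> \<notin> A} = (\<Inter>i\<in>{1..n}. X i -` (space N - A) \<inter> space M)"
    using False measurable_space[OF meas] by fastforce
  also have "prob \<dots> = (\<Prod>i\<in>{1..n}. prob (X i -` (space N - A) \<inter> space M))"
    using False A by (intro indep_varsD[OF indep]) auto
  also have "\<dots> \<le> (\<Prod>i\<in>{1..n}. exp (- p))"
    using single by (intro prod_mono) auto
  also have "\<dots> = exp (- (real n * p))"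
    by (simp flip: exp_of_nat_mult)
  finally show ?thesis .
qed simp

lemma (in prob_space) prob_no_empty_ball_ge:
  fixes X :: "nat \<Rightarrow> 'a \<Rightarrow> 'b::metric_space"
  assumes indep: "indep_vars (\<lambda>_. borel) X {1..}" and fin: "finite C"
    and p: "\<And>x i. x \<in> C \<Longrightarrow> i \<ge> 1 \<Longrightarrow> p \<le> prob {\<omega> \<in> space M. X i \<omega> \<in> ball x \<rho>}"
  shows "1 - real (card C) * exp (- (real n * p))
           \<le> prob {\<omega> \<in> space M. \<not> (\<exists>x\<in>C. empty_ball X n \<omega> \<rho> x)}"
proof -
  have [measurable]: "X i \<in> borel_measurable M" if "i \<in> {1..n}" for i
    using indep that unfolding indep_vars_def by auto
  have [measurable]: "ball x \<rho> \<in> sets borel" for x :: 'b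
    by simp
  let ?E = "\<lambda>x. {\<omega> \<in> space M. \<forall>i\<in>{1..n}. X i \<omega> \<notin> ball x \<rho>}"
  have E: "?E x \<in> events" for x
    by measurable
  have "{\<omega> \<in> space M. \<not> (\<exists>x\<in>C. empty_ball X n \<omega> \<rho> x)} = space M - (\<Union>x\<in>C. ?E x)"
    by (auto simp: empty_ball_def)
  also have "prob \<dots> = 1 - prob (\<Union>x\<in>C. ?E x)"
    using E fin by (intro prob_compl) auto
  finally have "prob {\<omega> \<in> space M. \<not> (\<exists>x\<in>C. empty_ball X n \<omega> \<rho> x)} = 1 - prob (\<Union>x\<in>C. ?E x)" .
  moreover have "prob (\<Union>x\<in>C. ?E x) \<le> (\<Sum>x\<in>C. prob (?E x))"
    using E fin by (intro finite_measure_subadditive_finite) auto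
  moreover have "\<dots> \<le> (\<Sum>x\<in>C. exp (- (real n * p)))"
    using p by (intro sum_mono prob_sample_avoids_le[OF indep]) auto
  ultimately show ?thesis
    by simp
qed

text \<open>The union bound is over pairs of a sample point and a ball, whence the product in the bound.\<close>

lemma (in prob_space) prob_all_balls_empty_ge:
  fixes X :: "nat \<Rightarrow> 'a \<Rightarrow> 'b::metric_space"
  assumes meas: "\<And>i. i \<ge> 1 \<Longrightarrow> X i \<in> borel_measurable M" and fin: "finite C"
    and q: "\<And>x i. x \<in> C \<Longrightarrow> i \<ge> 1 \<Longrightarrow> prob {\<omega> \<in> space M. X i \<omega> \<in> ball x \<rho>} \<le> q"
  shows "1 - real n * real (card C) * q
           \<le> prob {\<omega> \<in> space M. \<forall>x\<in>C. empty_ball X n \<omega> \<rho> x}"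
proof -
  let ?E = "\<lambda>(i, x). {\<omega> \<in> space M. X i \<omega> \<in> ball x \<rho>}"
  have E: "?E z \<in> events" if "z \<in> {1..n} \<times> C" for z
  proof -
    have [measurable]: "X (fst z) \<in> borel_measurable M"
      using meas that by auto
    have [measurable]: "ball (snd z) \<rho> \<in> sets borel"
      by simp
    have "{\<omega> \<in> space M. X (fst z) \<omega> \<in> ball (snd z) \<rho>} \<in> events"
      by measurable
    then show ?thesis
      by (simp add: case_prod_beta)
  qed
  have "{\<omega> \<in> space M. \<forall>x\<in>C. empty_ball X n \<omega> \<rho> x} = space M - (\<Union>z\<in>{1..n} \<times> C. ?E z)"
    by (auto simp: empty_ball_def)
  also have "prob \<dots> = 1 - prob (\<Union>z\<in>{1..n} \<times> C. ?E z)"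
    using E fin by (intro prob_compl sets.finite_UN) auto
  finally have "prob {\<omega> \<in> space M. \<forall>x\<in>C. empty_ball X n \<omega> \<rho> x}
      = 1 - prob (\<Union>z\<in>{1..n} \<times> C. ?E z)" .
  moreover have "prob (\<Union>z\<in>{1..n} \<times> C. ?E z) \<le> (\<Sum>z\<in>{1..n} \<times> C. prob (?E z))"
    using E fin by (intro finite_measure_subadditive_finite) auto
  moreover have "\<dots> \<le> (\<Sum>z\<in>{1..n} \<times> C. q)"
    using q by (intro sum_mono) auto
  ultimately show ?thesis
    by (simp add: card_cartesian_product)
qed

section \<open>Asymptotics\<close>

lemma two_sided_O_eventually_le:
  assumes "two_sided_O a b"
  obtains L where "0 < L" "\<forall>\<^sub>F n in sequentially. a n \<le> L * b n"
  using assms unfolding two_sided_O_def eventually_at_top_dense by (metis (no_types))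

lemma two_sided_O_eventually_ge:
  assumes "two_sided_O a b"
  obtains L where "0 < L" "\<forall>\<^sub>F n in sequentially. L * b n \<le> a n"
  using assms unfolding two_sided_O_def eventually_at_top_dense by (metis (no_types))

lemma powr_times_exp_neg_powr_tendsto_0:
  fixes a b c L :: real
  assumes "0 < b" "0 < c"
  shows "(\<lambda>n. L * real n powr a * exp (- (c * real n powr b))) \<longlonglongrightarrow> 0"
  using assms by real_asymp

lemma two_sided_O_neg_powr_tendsto_0:
  assumes "two_sided_O a (\<lambda>n. real n powr (- s))" "0 < s"
  shows "a \<longlonglongrightarrow> 0"
proof -
  obtain L where L: "\<forall>\<^sub>F n in sequentially. a n \<le> L * real n powr (- s)"
    using two_sided_O_eventually_le[OF assms(1)] by blast
  have "(\<lambda>n. L * real n powr (- s)) \<longlonglongrightarrow> 0"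
    using assms(2) by real_asymp
  moreover have "\<forall>\<^sub>F n in sequentially. 0 \<le> a n"
    using assms(1) unfolding two_sided_O_def
    by (intro eventually_sequentiallyI[of 1]) (auto intro: less_imp_le)
  ultimately show ?thesis
    using L by (intro tendsto_sandwich[OF _ L tendsto_const]) auto
qed

lemma (in prob_space) prob_tendsto_1:
  assumes "\<forall>\<^sub>F n in F. b n \<le> prob (E n)" "(b \<longlongrightarrow> 1) F"
  shows "((\<lambda>n. prob (E n)) \<longlongrightarrow> 1) F"
  using assms by (intro tendsto_sandwich[OF assms(1) _ assms(2) tendsto_const]) simp

section \<open>Occupancy of the covering balls in the limit\<close>

theorem theorem3p11:
  fixes P :: "'w measure"
    and X :: "nat \<Rightarrow> 'w \<Rightarrow> real ^ 'n"
    and f :: "real ^ 'n \<Rightarrow> real"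
    and M S0 :: "(real ^ 'n) set"
    and d0 \<epsilon>0 Lf Uf \<eta> \<psi> \<xi> :: real
    and C :: "nat \<Rightarrow> (real ^ 'n) set"
    and r \<epsilon> m :: "nat \<Rightarrow> real"
  defines "M \<equiv> unit_cube"
    and "S0 \<equiv> zero_density_region M f"
  assumes P: "prob_space P"
    and iid_indep: "prob_space.indep_vars P (\<lambda>_. borel) X {1..}"
    and iid_density: "\<And>i. i \<ge> 1 \<Longrightarrow> distributed P lborel (X i) (\<lambda>x. ennreal (f x))"
    and f_nonneg: "\<And>x. 0 \<le> f x"
    and support: "\<And>i. i \<ge> 1 \<Longrightarrow> rv_support P (X i) = M"
    and f_zero: "\<And>x. x \<notin> M \<Longrightarrow> f x = 0"
    and f_cont: "continuous_on M f"
    and dim: "has_minkowski_dimension S0 d0" "d0 < real CARD('n)"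
    and S0_interior: "S0 \<subseteq> interior M"
    and S0_component: "card (components S0) = 1"
    and i: "0 < \<epsilon>0"
      "0 < upper_eps_order f S0 \<epsilon>0" "upper_eps_order f S0 \<epsilon>0 < \<infinity>"
      "0 < lower_eps_order f S0 \<epsilon>0" "lower_eps_order f S0 \<epsilon>0 < \<infinity>"
    and ii: "0 < Lf" "0 < Uf"
      "\<And>e x. 0 < e \<Longrightarrow> e < min 1 \<epsilon>0 \<Longrightarrow> x \<in> eps_nbhd e S0 \<inter> M \<Longrightarrow>
         Lf * infdist x S0 powr real_of_ereal (upper_eps_order f S0 e) \<le> f x \<and>
         f x \<le> Uf * infdist x S0 powr real_of_ereal (lower_eps_order f S0 e)"
    and iii: "\<And>n. n \<ge> 1 \<Longrightarrow> C n \<subseteq> M \<and> ball_covering (C n) (r n) M"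
      "0 < \<eta>" "\<eta> < 1 / real CARD('n)"
      "two_sided_O r (\<lambda>n. real n powr (- \<eta>))"
      "two_sided_O (\<lambda>n. real (card (C n))) (\<lambda>n. real n powr (real CARD('n) * \<eta>))"
    and iv: "\<And>\<tau>. 0 < \<tau> \<Longrightarrow>
      \<exists>H. two_sided_O H (\<lambda>n. real n powr (d0 * \<eta> * (1 + \<tau>))) \<and>
          (\<forall>n\<ge>1. real (card {x \<in> C n. ball x (r n) \<inter> S0 \<noteq> {}}) \<le> H n)"
    and v: "0 < \<psi>" "\<psi> \<le> \<eta>"
      "two_sided_O \<epsilon> (\<lambda>n. real n powr (- \<psi>))"
      "\<And>n. n \<ge> 1 \<Longrightarrow> 2 * r n \<le> \<epsilon> n \<and> \<epsilon> n < 1"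
    and vi: "\<And>n. n \<ge> 1 \<Longrightarrow> is_minimum_on f (M - eps_nbhd (\<epsilon> n) S0) (m n) \<and> 0 < m n"
      "0 < \<xi>" "\<xi> < (1 - 2 * \<eta> * real CARD('n)) / 2"
      "two_sided_O m (\<lambda>n. real n powr (- \<xi>))"
  shows "(1 - 2 * \<eta> * real CARD('n) - 2 * real_of_ereal (upper_order f S0) * \<psi> > 0 \<longrightarrow>
       (\<lambda>n. measure P {\<omega> \<in> space P.
          \<not> (\<exists>x\<in>C n. outside_ball (\<epsilon> n) S0 x \<and> empty_ball X n \<omega> (r n) x)}) \<longlonglongrightarrow> 1) \<and>
    (1 + d0 * \<eta> - real_of_ereal (lower_order f S0) * \<eta> - real CARD('n) * \<eta> < 0 \<longrightarrow>
       (\<lambda>n. measure P {\<omega> \<in> space P.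
          \<forall>x\<in>C n. inside_ball (\<epsilon> n) S0 (r n) x \<longrightarrow> empty_ball X n \<omega> (r n) x}) \<longlonglongrightarrow> 1)"
proof -
  interpret prob_space P by (rule P)
  let ?d = "CARD('n)"
  let ?U = "\<lambda>e. real_of_ereal (upper_eps_order f S0 e)"
  let ?L = "\<lambda>e. real_of_ereal (lower_eps_order f S0 e)"
  have S0: "closed S0" "S0 \<noteq> {}" "S0 \<noteq> UNIV"
  proof -
    show "closed S0"
      unfolding S0_def zero_density_region_def
      by (intro continuous_closed_preimage_constant f_cont) (simp add: M_def unit_cube_def closed_cbox)
    show "S0 \<noteq> {}"
      using S0_component by auto
    have "bounded S0"
      by (rule bounded_subset[of M]) (auto simp: S0_def zero_density_region_def M_def unit_cube_def)
    then show "S0 \<noteq> UNIV"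
      using not_bounded_UNIV by auto
  qed
  have r: "0 < r n" "2 * r n \<le> \<epsilon> n" "\<epsilon> n < 1" if "n \<ge> 1" for n
    using iii(4) v(4) that by (auto simp: two_sided_O_def)
  have C: "C n \<subseteq> unit_cube" "finite (C n)" if "n \<ge> 1" for n
    using iii(1)[OF that] by (auto simp: ball_covering_def M_def)
  have meas: "X i \<in> borel_measurable P" if "i \<ge> 1" for i
    using iid_indep that unfolding indep_vars_def by auto
  have \<epsilon>_small: "\<forall>\<^sub>F n in sequentially. \<epsilon> n < e" if "0 < e" for e
    using order_tendstoD(2)[OF two_sided_O_neg_powr_tendsto_0[OF v(3,1)] that] .

  have A: "(\<lambda>n. prob {\<omega> \<in> space P. \<not> (\<exists>x\<in>C n. outside_ball (\<epsilon> n) S0 x \<and> empty_ball X n \<omega> (r n) x)})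
      \<longlonglongrightarrow> 1"
    if gap: "1 - 2 * \<eta> * real ?d - 2 * real_of_ereal (upper_order f S0) * \<psi> > 0"
  proof -
    let ?K = "real_of_ereal (upper_order f S0)"
    have "0 < (1 - 2 * \<eta> * real ?d - 2 * ?K * \<psi>) / (2 * \<psi>)"
      using gap v(1) by simp
    moreover have "0 < min 1 \<epsilon>0" "upper_eps_order f S0 (min 1 \<epsilon>0) < \<infinity>"
      using i upper_eps_order_mono[of "min 1 \<epsilon>0" \<epsilon>0 f S0] by auto
    ultimately obtain e where e: "0 < e" "e < min 1 \<epsilon>0" "0 \<le> ?U e"
        "?U e < ?K + (1 - 2 * \<eta> * real ?d - 2 * ?K * \<psi>) / (2 * \<psi>)"
      using upper_order_approx by metis
    have "\<psi> * ?U e < \<psi> * (?K + (1 - 2 * \<eta> * real ?d - 2 * ?K * \<psi>) / (2 * \<psi>))"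
      using e(4) v(1) by simp
    also have "\<dots> = (1 - 2 * \<eta> * real ?d) / 2"
      using v(1) by (simp add: field_simps)
    finally have k: "\<psi> * ?U e < (1 - 2 * \<eta> * real ?d) / 2" .
    \<comment> \<open>the faster of the two polynomial rates at which the density may decay on outside balls\<close>
    define \<beta> where "\<beta> = max \<xi> (\<psi> * ?U e)"
    have exponent: "0 < 1 - \<eta> * real ?d - \<beta>"
    proof -
      have "0 < \<eta> * real ?d"
        using iii(2) by simp
      moreover have "\<beta> < 1 / 2 - \<eta> * real ?d"
        using k vi(3) by (simp add: \<beta>_def field_simps)
      ultimately show ?thesis by linarith
    qed
    obtain R where R: "0 < R" "\<forall>\<^sub>F n in sequentially. R * real n powr (- \<eta>) \<le> r n"
      using two_sided_O_eventually_ge[OF iii(4)] .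
    obtain E where E: "0 < E" "\<forall>\<^sub>F n in sequentially. E * real n powr (- \<psi>) \<le> \<epsilon> n"
      using two_sided_O_eventually_ge[OF v(3)] .
    obtain m1 where m1: "0 < m1" "\<forall>\<^sub>F n in sequentially. m1 * real n powr (- \<xi>) \<le> m n"
      using two_sided_O_eventually_ge[OF vi(4)] .
    obtain B where B: "0 < B"
        "\<forall>\<^sub>F n in sequentially. real (card (C n)) \<le> B * real n powr (real ?d * \<eta>)"
      using two_sided_O_eventually_le[OF iii(5)] .
    define c where "c = min m1 (Lf * (E / 2) powr ?U e)"
    have "0 < c"
      using m1(1) E(1) ii(1) by (simp add: c_def)
    define c' where "c' = c * (R / (2 * real ?d)) ^ ?d"
    have "0 < c'"
      using \<open>0 < c\<close> R(1) by (simp add: c'_def)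
    let ?bound = "\<lambda>n. B * real n powr (real ?d * \<eta>) * exp (- (c' * real n powr (1 - \<eta> * real ?d - \<beta>)))"
    have "\<forall>\<^sub>F n in sequentially. 1 - ?bound n \<le>
        prob {\<omega> \<in> space P. \<not> (\<exists>x\<in>C n. outside_ball (\<epsilon> n) S0 x \<and> empty_ball X n \<omega> (r n) x)}"
      using R(2) E(2) m1(2) B(2) \<epsilon>_small[OF e(1)] eventually_ge_at_top[of 1]
    proof eventually_elim
      case (elim n)
      note n = \<open>1 \<le> n\<close>
      \<comment> \<open>near \<open>S0\<close> the lower density bound applies, elsewhere the minimum \<open>m n\<close>\<close>
      have f_lower: "c * real n powr (- \<beta>) \<le> f y" if y: "y \<in> M" "\<epsilon> n / 2 \<le> infdist y S0" for y
      proof (cases "infdist y S0 < \<epsilon> n")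
        case True
        have "c * real n powr (- \<beta>) \<le> Lf * (E / 2) powr ?U e * real n powr (- (\<psi> * ?U e))"
          using n ii(1) by (intro mult_mono powr_mono) (auto simp: c_def \<beta>_def)
        also have "\<dots> = Lf * (E * real n powr (- \<psi>) / 2) powr ?U e"
          using E(1) by (simp add: powr_mult powr_divide powr_powr)
        also have "\<dots> \<le> Lf * infdist y S0 powr ?U e"
          using y(2) elim(2) E(1) e(3) ii(1) by (intro mult_left_mono powr_mono2) auto
        also have "\<dots> \<le> f y"
          using ii(3)[OF e(1,2), of y] y(1) True elim(5) by (auto simp: eps_nbhd_def)
        finally show ?thesis .
      next
        case False
        have "c * real n powr (- \<beta>) \<le> m1 * real n powr (- \<xi>)"
          using n m1(1) by (intro mult_mono powr_mono) (auto simp: c_def \<beta>_def)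
        also have "\<dots> \<le> f y"
          using elim(3) vi(1)[OF n] False y(1) by (force simp: is_minimum_on_def eps_nbhd_def)
        finally show ?thesis .
      qed
      let ?O = "{x \<in> C n. outside_ball (\<epsilon> n) S0 x}"
      let ?p = "c * real n powr (- \<beta>) * (r n / (2 * real ?d)) ^ ?d"
      have hit: "?p \<le> prob {\<omega> \<in> space P. X i \<omega> \<in> ball x (r n)}" if x: "x \<in> ?O" and i: "i \<ge> 1" for x i
      proof (rule prob_ball_centered_in_cube_ge[OF iid_density[OF i]])
        show "x \<in> unit_cube" "0 < r n" "r n \<le> 1" "0 \<le> c * real n powr (- \<beta>)"
          using x C[OF n] r[OF n] \<open>0 < c\<close> by auto
        fix y assume y: "y \<in> unit_cube" "y \<in> ball x (r n)"
        have "\<epsilon> n \<le> infdist x S0"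
          using x by (simp add: outside_ball_def eps_nbhd_def)
        also have "\<dots> \<le> infdist y S0 + dist x y"
          by (rule infdist_triangle)
        finally have "\<epsilon> n / 2 \<le> infdist y S0"
          using y(2) r[OF n] by simp
        then show "c * real n powr (- \<beta>) \<le> f y"
          using f_lower y(1) by (simp add: M_def)
      qed
      have "c' * real n powr (1 - \<eta> * real ?d - \<beta>)
          = real n * (c * real n powr (- \<beta>) * (R * real n powr (- \<eta>) / (2 * real ?d)) ^ ?d)"
      proof -
        have "real n powr (1 - \<eta> * real ?d - \<beta>)
            = real n powr 1 * real n powr (- (\<eta> * real ?d)) * real n powr (- \<beta>)"
          by (simp only: diff_conv_add_uminus powr_add)
        also have "real n powr (- (\<eta> * real ?d)) = (real n powr (- \<eta>)) ^ ?d"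
          using n by (simp add: powr_powr flip: powr_realpow)
        finally show ?thesis
          using n by (simp add: c'_def power_mult_distrib power_divide)
      qed
      also have "\<dots> \<le> real n * ?p"
        using \<open>0 < c\<close> elim(1) R(1) by (intro mult_left_mono power_mono divide_right_mono) auto
      finally have "exp (- (real n * ?p)) \<le> exp (- (c' * real n powr (1 - \<eta> * real ?d - \<beta>)))"
        by simp
      moreover have "real (card ?O) \<le> real (card (C n))"
        using C(2)[OF n] by (auto intro: card_mono)
      ultimately have "real (card ?O) * exp (- (real n * ?p)) \<le> ?bound n"
        using elim(4) B(1) by (intro mult_mono) auto
      moreover have "1 - real (card ?O) * exp (- (real n * ?p))
          \<le> prob {\<omega> \<in> space P. \<not> (\<exists>x\<in>?O. empty_ball X n \<omega> (r n) x)}"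
        using hit C(2)[OF n] by (intro prob_no_empty_ball_ge[OF iid_indep]) auto
      moreover have "prob {\<omega> \<in> space P. \<not> (\<exists>x\<in>?O. empty_ball X n \<omega> (r n) x)}
          = prob {\<omega> \<in> space P. \<not> (\<exists>x\<in>C n. outside_ball (\<epsilon> n) S0 x \<and> empty_ball X n \<omega> (r n) x)}"
        by (intro arg_cong[where f = prob]) auto
      ultimately show ?case
        by linarith
    qed
    moreover have "(\<lambda>n. 1 - ?bound n) \<longlonglongrightarrow> 1 - 0"
      by (rule tendsto_diff[OF tendsto_const powr_times_exp_neg_powr_tendsto_0[OF exponent \<open>0 < c'\<close>]])
    ultimately show ?thesis
      by (elim prob_tendsto_1) simp
  qed

  have B: "(\<lambda>n. prob {\<omega> \<in> space P. \<forall>x\<in>C n. inside_ball (\<epsilon> n) S0 (r n) x \<longrightarrow> empty_ball X n \<omega> (r n) x})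
      \<longlonglongrightarrow> 1"
    if gap: "1 + d0 * \<eta> - real_of_ereal (lower_order f S0) * \<eta> - real ?d * \<eta> < 0"
  proof -
    let ?K = "real_of_ereal (lower_order f S0)"
    define g where "g = - (1 + d0 * \<eta> - ?K * \<eta> - real ?d * \<eta>)"
    have "0 < g"
      using gap by (simp add: g_def)
    \<comment> \<open>the gap \<open>g\<close> is divided into thirds: one for \<open>\<tau>\<close>, one for passing to the scale \<open>e\<close>, one remains\<close>
    define \<tau> where "\<tau> = g / (3 * \<eta> * (\<bar>d0\<bar> + 1))"
    have \<tau>: "0 < \<tau>" "d0 * \<eta> * \<tau> \<le> g / 3"
    proof -
      show "0 < \<tau>"
        using \<open>0 < g\<close> iii(2) by (simp add: \<tau>_def)
      have "d0 * \<eta> * \<tau> = g / 3 * (d0 / (\<bar>d0\<bar> + 1))"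
        using iii(2) by (simp add: \<tau>_def)
      also have "\<dots> \<le> g / 3 * 1"
        using \<open>0 < g\<close> by (intro mult_left_mono) (auto simp: divide_simps)
      finally show "d0 * \<eta> * \<tau> \<le> g / 3" by simp
    qed
    have "0 < min 1 \<epsilon>0" "upper_eps_order f S0 (min 1 \<epsilon>0) < \<infinity>" "0 < lower_eps_order f S0 (min 1 \<epsilon>0)"
        "0 < g / (3 * \<eta>)"
      using i upper_eps_order_mono[of "min 1 \<epsilon>0" \<epsilon>0 f S0]
        lower_eps_order_antimono[of "min 1 \<epsilon>0" \<epsilon>0 f S0] \<open>0 < g\<close> iii(2) by auto
    then obtain e where e: "0 < e" "e < min 1 \<epsilon>0" "0 \<le> ?L e" "?K - g / (3 * \<eta>) < ?L e"
      using lower_order_approx[OF S0] by metis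
    define s where "s = 1 + d0 * \<eta> * (1 + \<tau>) - real ?d * \<eta> - ?L e * \<eta>"
    have "s < 0"
    proof -
      have "(?K - g / (3 * \<eta>)) * \<eta> < ?L e * \<eta>"
        using e(4) iii(2) by simp
      moreover have "(?K - g / (3 * \<eta>)) * \<eta> = ?K * \<eta> - g / 3"
        using iii(2) by (simp add: field_simps)
      moreover have "s = - g + d0 * \<eta> * \<tau> + ?K * \<eta> - ?L e * \<eta>"
        by (simp add: s_def g_def algebra_simps)
      ultimately show ?thesis
        using \<tau>(2) \<open>0 < g\<close> by linarith
    qed
    obtain H where H: "two_sided_O H (\<lambda>n. real n powr (d0 * \<eta> * (1 + \<tau>)))"
        "\<And>n. n \<ge> 1 \<Longrightarrow> real (card {x \<in> C n. ball x (r n) \<inter> S0 \<noteq> {}}) \<le> H n"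
      using iv[OF \<tau>(1)] by blast
    obtain h where h: "0 < h" "\<forall>\<^sub>F n in sequentially. H n \<le> h * real n powr (d0 * \<eta> * (1 + \<tau>))"
      using two_sided_O_eventually_le[OF H(1)] .
    obtain R where R: "0 < R" "\<forall>\<^sub>F n in sequentially. r n \<le> R * real n powr (- \<eta>)"
      using two_sided_O_eventually_le[OF iii(4)] .
    let ?v = "unit_ball_vol (real ?d)"
    define A where "A = h * (Uf * (2 * R) powr ?L e * (?v * R ^ ?d))"
    have "\<forall>\<^sub>F n in sequentially. 1 - A * real n powr s \<le>
        prob {\<omega> \<in> space P. \<forall>x\<in>C n. inside_ball (\<epsilon> n) S0 (r n) x \<longrightarrow> empty_ball X n \<omega> (r n) x}"
      using h(2) R(2) \<epsilon>_small[OF e(1)] eventually_ge_at_top[of 1]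
    proof eventually_elim
      case (elim n)
      note n = \<open>1 \<le> n\<close>
      let ?I = "{x \<in> C n. inside_ball (\<epsilon> n) S0 (r n) x}"
      let ?c = "Uf * (2 * r n) powr ?L e"
      let ?q = "?c * (?v * r n ^ ?d)"
      have hit: "prob {\<omega> \<in> space P. X i \<omega> \<in> ball x (r n)} \<le> ?q" if x: "x \<in> ?I" and i: "i \<ge> 1" for x i
      proof -
        have "f y \<le> ?c" if y: "y \<in> ball x (r n)" for y
        proof (cases "y \<in> M")
          case True
          obtain z where z: "z \<in> S0" "dist x z < r n"
            using x by (auto simp: inside_ball_def)
          have "infdist y S0 \<le> dist y z"
            by (rule infdist_le[OF z(1)])
          also have "\<dots> \<le> dist x y + dist x z"
            by (rule dist_triangle3)
          finally have d: "infdist y S0 \<le> 2 * r n"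
            using y z(2) by simp
          then have "y \<in> eps_nbhd e S0"
            using r(2)[OF n] elim(3) by (simp add: eps_nbhd_def)
          then have "f y \<le> Uf * infdist y S0 powr ?L e"
            using ii(3)[OF e(1,2), of y] True by auto
          also have "\<dots> \<le> ?c"
            using d e(3) ii(2) by (intro mult_left_mono powr_mono2) (auto simp: infdist_nonneg)
          finally show ?thesis .
        qed (use f_zero ii(2) in simp)
        then show ?thesis
          using prob_ball_le[OF iid_density[OF i], of "r n" ?c x] r(1)[OF n] ii(2) by auto
      qed
      have "real (card ?I) \<le> real (card {x \<in> C n. ball x (r n) \<inter> S0 \<noteq> {}})"
        using C(2)[OF n] by (auto intro!: card_mono simp: inside_ball_def)
      also have "\<dots> \<le> h * real n powr (d0 * \<eta> * (1 + \<tau>))"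
        using H(2)[OF n] elim(1) by linarith
      finally have card: "real (card ?I) \<le> h * real n powr (d0 * \<eta> * (1 + \<tau>))" .
      let ?R = "R * real n powr (- \<eta>)"
      have q: "?q \<le> Uf * (2 * ?R) powr ?L e * (?v * ?R ^ ?d)"
        using elim(2) r(1)[OF n] e(3) ii(2) R(1)
        by (intro mult_mono powr_mono2 power_mono mult_nonneg_nonneg) (auto simp: less_imp_le)
      have "real n * real (card ?I) * ?q
          \<le> real n * (h * real n powr (d0 * \<eta> * (1 + \<tau>))) * (Uf * (2 * ?R) powr ?L e * (?v * ?R ^ ?d))"
        using h(1) ii(2) r(1)[OF n] by (intro mult_mono[OF mult_left_mono[OF card] q]) auto
      also have "\<dots> = A * real n powr s"
      proof -
        have "real n powr s = real n powr 1 * real n powr (d0 * \<eta> * (1 + \<tau>))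
            * real n powr (- (real ?d * \<eta>)) * real n powr (- (?L e * \<eta>))"
          by (simp only: s_def diff_conv_add_uminus powr_add)
        also have "real n powr (- (real ?d * \<eta>)) = (real n powr (- \<eta>)) ^ ?d"
          using n by (simp add: powr_powr mult.commute flip: powr_realpow)
        also have "real n powr (- (?L e * \<eta>)) = (real n powr (- \<eta>)) powr ?L e"
          by (simp add: powr_powr mult.commute)
        finally show ?thesis
          using n R(1) powr_mult[of "2 * R" "real n powr (- \<eta>)" "?L e"]
          by (simp add: A_def power_mult_distrib mult.assoc[of 2])
      qed
      finally have "real n * real (card ?I) * ?q \<le> A * real n powr s" .
      moreover have "1 - real n * real (card ?I) * ?q
          \<le> prob {\<omega> \<in> space P. \<forall>x\<in>?I. empty_ball X n \<omega> (r n) x}"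
        using hit C(2)[OF n] by (intro prob_all_balls_empty_ge[OF meas]) auto
      moreover have "prob {\<omega> \<in> space P. \<forall>x\<in>?I. empty_ball X n \<omega> (r n) x}
          = prob {\<omega> \<in> space P. \<forall>x\<in>C n. inside_ball (\<epsilon> n) S0 (r n) x \<longrightarrow> empty_ball X n \<omega> (r n) x}"
        by (intro arg_cong[where f = prob]) auto
      ultimately show ?case
        by linarith
    qed
    moreover have "(\<lambda>n. 1 - A * real n powr s) \<longlonglongrightarrow> 1"
      using \<open>s < 0\<close> by real_asymp
    ultimately show ?thesis
      by (rule prob_tendsto_1)
  qed
  from A B show ?thesis
    by blast
qed

end
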